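(* Let $\succeq_1,\ldots,\succeq_n,\succeq$ be monotone stationary time preferences, where each $\succeq_i$ is represented by $u(x)e^{-r_i\Phi_i(T)}$ and $\succeq$ is represented by $u(x)e^{-r\Phi(T)}$, for some monotone additive statistics $\Phi_1,\dots,\Phi_n,\Phi$, constants $r_1,\dots,r_n,r>0$, and a common continuous, strictly increasing function $u\colon\mathbb{R}_{++}\to\mathbb{R}_{++}$. Suppose that $\lim_{x\to0}u(x)=0$ or $\lim_{x\to\infty}u(x)=\infty$. Then the Pareto axiom is satisfied if and only if there exist $\lambda_1,\ldots,\lambda_n\in\mathbb{R}_+$ with $\sum_{i=1}^n\lambda_i=1$ such that $$r=\sum_{i=1}^n\lambda_ir_i\qquad\text{and}\qquad r\Phi=\sum_{i=1}^n\lambda_ir_i\Phi_i.$$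
   Context: $L^\infty_+$ is the set of non-negative bounded random variables on a fixed nonatomic probability space. $\mathbb{R}_{++}=(0,\infty)$, $\mathbb{R}_+=[0,\infty)$. A time lottery is a pair $(x,T)\in\mathbb{R}_{++}\times L^\infty_+$. A monotone additive statistic on $L^\infty_+$ is a map $\Phi\colon L^\infty_+\to\mathbb{R}$ that depends only on the distribution, satisfies $\Phi(c)=c$ for constants $c\ge0$, is additive for sums of independent random variables, and is monotone with respect to first-order stochastic dominance. A preference is represented by $V$ if $(x,T)\succeq(y,S)$ if and only if $V(x,T)\ge V(y,S)$. A monotone stationary time preference (MSTP) is a preference over time lotteries that is represented by $u(x)e^{-r\Phi(T)}$ for some monotone additive statistic $\Phi$, some $r>0$ and some continuous strictly increasing $u\colon\mathbb{R}_{++}\to\mathbb{R}_{++}$ (this is equivalent to its axiomatic definition). Pareto axiom: for all time lotteries, if $(x,T)\succeq_i(y,S)$ for every $i=1,\ldots,n$, then $(x,T)\succeq(y,S)$. *)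

theory Defs
  imports "HOL-Probability.Probability"
begin

definition nonatomic :: "'w measure \<Rightarrow> bool" where
  "nonatomic M \<longleftrightarrow>
    (\<forall>A\<in>sets M. measure M A > 0 \<longrightarrow>
      (\<exists>B\<in>sets M. B \<subseteq> A \<and> 0 < measure M B \<and> measure M B < measure M A))"

(* Random variables are functions rather than a.s.-equivalence classes; all notions below
   depend on them only up to a.s. equality. *)
definition Linf_plus :: "'w measure \<Rightarrow> ('w \<Rightarrow> real) set" where
  "Linf_plus M =
    {T \<in> borel_measurable M. (AE w in M. 0 \<le> T w) \<and> (\<exists>B. AE w in M. T w \<le> B)}"

definition fosd :: "'w measure \<Rightarrow> ('w \<Rightarrow> real) \<Rightarrow> ('w \<Rightarrow> real) \<Rightarrow> bool" where
  "fosd M X Y \<longleftrightarrow> (\<forall>t. cdf (distr M borel X) t \<le> cdf (distr M borel Y) t)"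

definition monotone_additive_statistic ::
    "'w measure \<Rightarrow> (('w \<Rightarrow> real) \<Rightarrow> real) \<Rightarrow> bool" where
  "monotone_additive_statistic M \<Phi> \<longleftrightarrow>
    (\<forall>X\<in>Linf_plus M. \<forall>Y\<in>Linf_plus M. distr M borel X = distr M borel Y \<longrightarrow> \<Phi> X = \<Phi> Y) \<and>
    (\<forall>c\<ge>0. \<Phi> (\<lambda>_. c) = c) \<and>
    (\<forall>X\<in>Linf_plus M. \<forall>Y\<in>Linf_plus M.
        prob_space.indep_var M borel X borel Y \<longrightarrow> \<Phi> (\<lambda>w. X w + Y w) = \<Phi> X + \<Phi> Y) \<and>
    (\<forall>X\<in>Linf_plus M. \<forall>Y\<in>Linf_plus M. fosd M X Y \<longrightarrow> \<Phi> X \<ge> \<Phi> Y)"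

type_synonym 'w time_lottery = "real \<times> ('w \<Rightarrow> real)"

(* "R a b" reads: a is weakly preferred to b.  Only its restriction to time_lotteries matters. *)
type_synonym 'w preference = "'w time_lottery \<Rightarrow> 'w time_lottery \<Rightarrow> bool"

definition time_lotteries :: "'w measure \<Rightarrow> 'w time_lottery set" where
  "time_lotteries M = {0<..} \<times> Linf_plus M"

definition represented_by ::
    "'w measure \<Rightarrow> 'w preference \<Rightarrow> (real \<Rightarrow> ('w \<Rightarrow> real) \<Rightarrow> real) \<Rightarrow> bool" where
  "represented_by M R V \<longleftrightarrow>
    (\<forall>(x, T)\<in>time_lotteries M. \<forall>(y, S)\<in>time_lotteries M. R (x, T) (y, S) \<longleftrightarrow> V x T \<ge> V y S)"

definition admissible_utility :: "(real \<Rightarrow> real) \<Rightarrow> bool" where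
  "admissible_utility u \<longleftrightarrow>
    continuous_on {0<..} u \<and> strict_mono_on {0<..} u \<and> (\<forall>x>0. u x > 0)"

definition MSTP :: "'w measure \<Rightarrow> 'w preference \<Rightarrow> bool" where
  "MSTP M R \<longleftrightarrow>
    (\<exists>u r \<Phi>. admissible_utility u \<and> r > 0 \<and> monotone_additive_statistic M \<Phi> \<and>
       represented_by M R (\<lambda>x T. u x * exp (- r * \<Phi> T)))"

definition pareto ::
    "'w measure \<Rightarrow> nat \<Rightarrow> (nat \<Rightarrow> 'w preference) \<Rightarrow> 'w preference \<Rightarrow> bool" where
  "pareto M n Rs R \<longleftrightarrow>
    (\<forall>a\<in>time_lotteries M. \<forall>b\<in>time_lotteries M. (\<forall>i\<in>{1..n}. Rs i a b) \<longrightarrow> R a b)"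

end

theory Submission
  imports Defs
begin

text \<open>
  Taking logarithms, and since \<open>ln \<circ> u\<close> has an interval unbounded on one side as its range, the Pareto axiom
  says that for all \<open>T\<close> and \<open>S\<close> the number \<open>r (\<Phi> T - \<Phi> S)\<close> is at most the maximum over \<open>i\<close> of
  \<open>r\<^sub>i (\<Phi>\<^sub>i T - \<Phi>\<^sub>i S)\<close>. Subtracting, the vectors \<open>w\<^sub>i = r\<^sub>i (\<Phi>\<^sub>i T - \<Phi>\<^sub>i S) - r (\<Phi> T - \<Phi> S)\<close>
  have a nonnegative coordinate. Nonatomicity provides independent copies, so by additivity these vectors
  form a subgroup of \<open>\<real>\<^sup>n\<close>, and a subgroup that avoids the open negative orthant is annihilated by a point
  of the simplex. It is enough to do this for finitely valued \<open>T\<close> and \<open>S\<close>: independent copies of these only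
  require splitting events into pieces of prescribed probability, and every statistic is
  1-Lipschitz in the supremum norm.
\<close>

section \<open>Events of prescribed measure in nonatomic spaces\<close>

text \<open>When an event splits into two pieces of positive measure, the smaller piece has at most
  half of the measure; repeated splitting therefore goes below any positive bound.\<close>

lemma (in finite_measure) nonatomic_small_subset:
  assumes "nonatomic M" "A \<in> sets M" "measure M A > 0" "e > 0"
  obtains B where "B \<in> sets M" "B \<subseteq> A" "0 < measure M B" "measure M B < e"
proof -
  have ex: "\<exists>B\<in>sets M. B \<subseteq> A \<and> 0 < measure M B \<and> measure M B \<le> measure M A / 2 ^ k" for k :: nat
  proof (induction k)
    case 0
    then show ?case using assms by auto
  next
    case (Suc k)
    then obtain B where B: "B \<in> sets M" "B \<subseteq> A" "0 < measure M B" "measure M B \<le> measure M A / 2 ^ k"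
      by blast
    obtain C where C: "C \<in> sets M" "C \<subseteq> B" "0 < measure M C" "measure M C < measure M B"
      using assms(1) B unfolding nonatomic_def by blast
    have "measure M (B - C) = measure M B - measure M C"
      using B C by (intro finite_measure_Diff) auto
    moreover have half: "x \<le> measure M A / 2 ^ Suc k" if "x \<le> measure M B / 2" for x
      using that B(4) by simp
    ultimately consider "measure M C \<le> measure M B / 2"
      | "0 < measure M (B - C)" "measure M (B - C) \<le> measure M B / 2"
      using C by linarith
    then show ?case
    proof cases
      case 1
      then show ?thesis using B C half by (intro bexI[of _ C]) auto
    next
      case 2
      then show ?thesis using B C half by (intro bexI[of _ "B - C"]) auto
    qed
  qed
  obtain k :: nat where "measure M A / e < 2 ^ k"
    using real_arch_pow[of 2] by auto
  then have "measure M A / 2 ^ k < e"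
    using assms(4) by (simp add: field_simps)
  with ex[of k] show thesis
    using that by force
qed

text \<open>Sierpinski's theorem, by greedy exhaustion: starting from the empty set, each step adds
  an event at least half as large as the supremum of what still fits into \<open>A\<close> without
  exceeding \<open>t\<close>. The union of the resulting chain has measure \<open>t\<close>.\<close>

lemma (in finite_measure) nonatomic_subset_measure:
  assumes "nonatomic M" "A \<in> sets M" "0 \<le> t" "t \<le> measure M A"
  obtains B where "B \<in> sets M" "B \<subseteq> A" "measure M B = t"
proof -
  define admissible where
    "admissible B = {C \<in> sets M. C \<subseteq> A - B \<and> measure M B + measure M C \<le> t}" for B
  define P where "P B \<longleftrightarrow> B \<in> sets M \<and> B \<subseteq> A \<and> measure M B \<le> t" for B
  \<comment> \<open>The supremum of the measures of admissible events is not known to be attained,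
    so an increment is only asked to reach half of it; this is the factor 2.\<close>
  define Q where "Q B B' \<longleftrightarrow> B \<subseteq> B' \<and>
    (\<forall>C\<in>admissible B. measure M C \<le> 2 * (measure M B' - measure M B))" for B B'
  have step: "\<exists>B'. P B' \<and> Q B B'" if "P B" for B
  proof -
    let ?s = "Sup (measure M ` admissible B)"
    have bdd: "bdd_above (measure M ` admissible B)"
    proof (intro bdd_aboveI2)
      show "measure M C \<le> t" if "C \<in> admissible B" for C
        using that measure_nonneg[of M B] unfolding admissible_def mem_Collect_eq by linarith
    qed
    have le: "measure M C \<le> ?s" if "C \<in> admissible B" for C
      using bdd that by (intro cSup_upper) auto
    have empty: "{} \<in> admissible B"
      using that by (auto simp: admissible_def P_def)
    have "\<exists>C\<in>admissible B. ?s / 2 \<le> measure M C"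
    proof (cases "?s > 0")
      case True
      then have "?s / 2 < ?s" by simp
      then show ?thesis
        using less_cSup_iff[OF _ bdd, of "?s / 2"] empty by (auto intro: less_imp_le)
    next
      case False
      then show ?thesis using empty by (intro bexI[of _ "{}"]) auto
    qed
    then obtain C where C: "C \<in> admissible B" "?s / 2 \<le> measure M C" by blast
    have union: "measure M (B \<union> C) = measure M B + measure M C"
      using C that by (intro finite_measure_Union) (auto simp: admissible_def P_def)
    have "measure M C' \<le> 2 * measure M C" if "C' \<in> admissible B" for C'
      using le[OF that] C(2) by simp
    then have "Q B (B \<union> C)" by (simp add: Q_def union)
    moreover have "P (B \<union> C)"
      using C(1) that union by (auto simp: P_def admissible_def)
    ultimately show ?thesis by blast
  qed
  have "P {}" using assms by (simp add: P_def)
  then obtain F where F: "\<And>k :: nat. P (F k)" "\<And>k. Q (F k) (F (Suc k))"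
    using dependent_nat_choice[of "\<lambda>_. P" "\<lambda>_. Q"] step by blast
  define U where "U = (\<Union>k. F k)"
  have lim: "(\<lambda>k. measure M (F k)) \<longlonglongrightarrow> measure M U"
    unfolding U_def using F
    by (intro finite_Lim_measure_incseq incseq_SucI) (auto simp: P_def Q_def)
  have U: "U \<in> sets M" "U \<subseteq> A"
    using F by (auto simp: U_def P_def)
  have le: "measure M U \<le> t"
    using lim F(1) by (intro LIMSEQ_le_const2[OF lim]) (auto simp: P_def)
  have "measure M U = t"
  proof (rule ccontr)
    assume "measure M U \<noteq> t"
    then have less: "measure M U < t" using le by simp
    have "measure M (A - U) > 0"
      using U less assms by (subst finite_measure_Diff) auto
    then obtain D where D: "D \<in> sets M" "D \<subseteq> A - U" "0 < measure M D" "measure M D < t - measure M U"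
      using nonatomic_small_subset[OF assms(1), of "A - U" "t - measure M U"] U assms(2) less
      by auto
    \<comment> \<open>\<open>D\<close> avoids the whole chain and fits below \<open>t\<close> at
      every stage, so its measure is at most twice every increment, and the increments tend to
      0.\<close>
    have "D \<in> admissible (F k)" for k
    proof -
      have "measure M (F k) \<le> measure M U"
        using F U by (intro finite_measure_mono) (auto simp: U_def)
      then show ?thesis using D by (auto simp: admissible_def U_def)
    qed
    then have *: "measure M D \<le> 2 * (measure M (F (Suc k)) - measure M (F k))" for k
      using F(2) by (auto simp: Q_def)
    have "(\<lambda>k. 2 * (measure M (F (Suc k)) - measure M (F k))) \<longlonglongrightarrow> 2 * (measure M U - measure M U)"
      by (intro tendsto_intros LIMSEQ_Suc lim)
    then have "measure M D \<le> 2 * (measure M U - measure M U)"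
      by (rule LIMSEQ_le_const) (use * in auto)
    then show False using D by simp
  qed
  then show thesis using U that by blast
qed

text \<open>Each label in turn is given an event carved out of what remains, and the last label
  takes the rest. Recording the partition as a labelling \<open>g\<close> makes the cells disjoint
  automatically and lets the labels later serve as values of a random variable.\<close>

lemma (in finite_measure) nonatomic_partition:
  assumes "nonatomic M" "finite J" "J \<noteq> {}" "A \<in> sets M"
    and "\<And>j. j \<in> J \<Longrightarrow> 0 \<le> p j" "(\<Sum>j\<in>J. p j) = measure M A"
  shows "\<exists>g. (\<forall>w\<in>A. g w \<in> J) \<and> (\<forall>j\<in>J. {w \<in> A. g w = j} \<in> sets M \<and> measure M {w \<in> A. g w = j} = p j)"
  using assms(2-6)
proof (induction J arbitrary: A rule: finite_ne_induct)
  case (singleton j)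
  then show ?case by (intro exI[of _ "\<lambda>_. j"]) auto
next
  case (insert j J)
  have "p j \<le> measure M A"
    using insert by (simp add: insert.prems(3)[symmetric] sum_nonneg)
  then obtain B where B: "B \<in> sets M" "B \<subseteq> A" "measure M B = p j"
    using nonatomic_subset_measure[OF assms(1), of A "p j"] insert.prems by auto
  have "(\<Sum>j\<in>J. p j) = measure M (A - B)"
    using B insert by (subst finite_measure_Diff) (auto simp: insert.prems(3)[symmetric])
  then have "\<exists>g. (\<forall>w\<in>A - B. g w \<in> J) \<and> (\<forall>i\<in>J. {w \<in> A - B. g w = i} \<in> sets M \<and>
      measure M {w \<in> A - B. g w = i} = p i)"
    using insert.prems B by (intro insert.IH) auto
  then obtain g where g: "\<And>w. w \<in> A - B \<Longrightarrow> g w \<in> J"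
      "\<And>i. i \<in> J \<Longrightarrow> {w \<in> A - B. g w = i} \<in> sets M"
      "\<And>i. i \<in> J \<Longrightarrow> measure M {w \<in> A - B. g w = i} = p i"
    by blast
  define h where "h w = (if w \<in> B then j else g w)" for w
  have "{w \<in> A. h w = j} = B"
    using B g(1) insert.hyps by (auto simp: h_def)
  moreover have "{w \<in> A. h w = i} = {w \<in> A - B. g w = i}" if "i \<in> J" for i
    using B that insert.hyps by (auto simp: h_def)
  ultimately show ?case
    using B g by (intro exI[of _ h]) (auto simp: h_def)
qed

section \<open>Independent copies of simple random variables\<close>

text \<open>The preimages form intersection-stable generators of the two sigma-algebras in the
  characterisation of independence, so the product rule need only be checked on them.\<close>

lemma (in prob_space) indep_varI:
  assumes "random_variable S X" "random_variable T Y"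
    and "\<And>A B. A \<in> sets S \<Longrightarrow> B \<in> sets T \<Longrightarrow>
      prob ((X -` A \<inter> space M) \<inter> (Y -` B \<inter> space M)) = prob (X -` A \<inter> space M) * prob (Y -` B \<inter> space M)"
  shows "indep_var S X T Y"
proof -
  have stable: "Int_stable {Z -` A \<inter> space M |A. A \<in> sets N}" for Z :: "'a \<Rightarrow> 'x" and N
  proof (rule Int_stableI, safe)
    fix A B assume "A \<in> sets N" "B \<in> sets N"
    then show "\<exists>C. Z -` A \<inter> space M \<inter> (Z -` B \<inter> space M) = Z -` C \<inter> space M \<and> C \<in> sets N"
      by (intro exI[of _ "A \<inter> B"]) auto
  qed
  show ?thesis
    unfolding indep_var_eq using assms
    by (intro conjI indep_set_sigma_sets stable indep_setI) (auto simp: measurable_sets)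
qed

lemma (in prob_space) indep_var_const:
  assumes "random_variable S X" "c \<in> space T"
  shows "indep_var S X T (\<lambda>_. c)"
  using assms
proof (intro indep_varI)
  fix A B assume "A \<in> sets S" "B \<in> sets T"
  then show "prob ((X -` A \<inter> space M) \<inter> ((\<lambda>_. c) -` B \<inter> space M)) =
      prob (X -` A \<inter> space M) * prob ((\<lambda>_. c) -` B \<inter> space M)"
    by (cases "c \<in> B") (auto simp: vimage_def prob_space)
qed auto

text \<open>A preimage under a simple function is a finite disjoint union of fibres. This reduces
  independence and equality of laws to the probabilities of single values.\<close>

lemma (in finite_measure) measure_Int_vimage_simple:
  assumes "simple_function M Y" "A \<in> sets M"
  shows "measure M (A \<inter> (Y -` B \<inter> space M)) =
    (\<Sum>y\<in>Y ` space M \<inter> B. measure M (A \<inter> (Y -` {y} \<inter> space M)))"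
proof -
  have "A \<inter> (Y -` B \<inter> space M) = (\<Union>y\<in>Y ` space M \<inter> B. A \<inter> (Y -` {y} \<inter> space M))"
    by auto
  also have "measure M \<dots> = (\<Sum>y\<in>Y ` space M \<inter> B. measure M (A \<inter> (Y -` {y} \<inter> space M)))"
    using assms
    by (intro finite_measure_finite_Union) (auto simp: simple_functionD disjoint_family_on_def)
  finally show ?thesis .
qed

lemma (in finite_measure) measure_vimage_simple:
  assumes "simple_function M Y"
  shows "measure M (Y -` B \<inter> space M) =
    (\<Sum>y\<in>Y ` space M \<inter> B. measure M (Y -` {y} \<inter> space M))"
  using measure_Int_vimage_simple[OF assms, of "space M" B] by (simp add: Int_absorb1)

text \<open>Each fibre of \<open>X\<close> is cut into pieces labelled by the values of
  \<open>Y\<close>, in the proportions of the law of \<open>Y\<close>. The label \<open>Z\<close>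
  then has that law conditionally on every value of \<open>X\<close> of positive probability, which
  gives both independence and the right distribution.\<close>

lemma (in prob_space) nonatomic_indep_copy:
  fixes X Y :: "'a \<Rightarrow> real"
  assumes "nonatomic M" "simple_function M X" "simple_function M Y"
  obtains Z where "simple_function M Z" "Z ` space M \<subseteq> Y ` space M" "indep_var borel X borel Z"
    "distr M borel Z = distr M borel Y"
proof -
  let ?V = "Y ` space M"
  define A where "A x = X -` {x} \<inter> space M" for x
  define q where "q y = prob (Y -` {y} \<inter> space M)" for y
  have V: "finite ?V" "?V \<noteq> {}"
    using assms not_empty by (auto simp: simple_functionD)
  have A: "A x \<in> events" for x
    using assms by (simp add: A_def simple_functionD)
  have q1: "(\<Sum>y\<in>?V. q y) = 1"
    using measure_vimage_simple[OF assms(3), of UNIV] by (simp add: q_def prob_space)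
  have "(\<Sum>y\<in>?V. prob (A x) * q y) = prob (A x)" for x
    using q1 by (simp flip: sum_distrib_left)
  \<comment> \<open>For \<open>x\<close> outside the range of \<open>X\<close> the fibre
    \<open>A x\<close> is empty and all pieces have measure 0, so a single choice function covers
    all reals.\<close>
  then have "\<forall>x. \<exists>g. (\<forall>w\<in>A x. g w \<in> ?V) \<and> (\<forall>y\<in>?V. {w \<in> A x. g w = y} \<in> events \<and>
      prob {w \<in> A x. g w = y} = prob (A x) * q y)"
    using V A by (intro allI nonatomic_partition[OF assms(1)]) (auto simp: q_def)
  from choice[OF this]
  obtain g where g: "\<And>x w. w \<in> A x \<Longrightarrow> g x w \<in> ?V"
      "\<And>x y. y \<in> ?V \<Longrightarrow> {w \<in> A x. g x w = y} \<in> events"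
      "\<And>x y. y \<in> ?V \<Longrightarrow> prob {w \<in> A x. g x w = y} = prob (A x) * q y"
    by blast
  define Z where "Z w = g (X w) w" for w
  have Zin: "Z ` space M \<subseteq> ?V"
    using g(1) by (auto simp: Z_def A_def)
  have AZ: "A x \<inter> (Z -` {y} \<inter> space M) = {w \<in> A x. g x w = y}" for x y
    by (auto simp: A_def Z_def)
  have Zsets: "Z -` {y} \<inter> space M \<in> events" if "y \<in> ?V" for y
  proof -
    have "Z -` {y} \<inter> space M = (\<Union>x\<in>X ` space M. {w \<in> A x. g x w = y})"
      by (auto simp: A_def Z_def)
    then show ?thesis
      using g(2)[OF that] simple_functionD(1)[OF assms(2)] by (simp only: sets.finite_UN)
  qed
  have Z: "simple_function M Z"
    unfolding simple_function_def using Zin V Zsets by (auto intro: finite_subset)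
  have joint: "prob (A x \<inter> (Z -` B \<inter> space M)) = prob (A x) * prob (Y -` B \<inter> space M)" for x B
  proof -
    have "prob (A x \<inter> (Z -` B \<inter> space M)) =
        (\<Sum>y\<in>Z ` space M \<inter> B. prob (A x \<inter> (Z -` {y} \<inter> space M)))"
      by (rule measure_Int_vimage_simple[OF Z A])
    \<comment> \<open>A value of \<open>Y\<close> that \<open>Z\<close> misses has an empty fibre
      under \<open>Z\<close>, so the sum may run over all values of \<open>Y\<close>.\<close>
    also have "\<dots> = (\<Sum>y\<in>?V \<inter> B. prob (A x \<inter> (Z -` {y} \<inter> space M)))"
    proof (intro sum.mono_neutral_left ballI)
      fix y assume "y \<in> ?V \<inter> B - Z ` space M \<inter> B"
      then have "Z -` {y} \<inter> space M = {}" by blast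
      then show "prob (A x \<inter> (Z -` {y} \<inter> space M)) = 0" by simp
    qed (use V Zin in auto)
    also have "\<dots> = (\<Sum>y\<in>?V \<inter> B. prob (A x) * q y)"
      by (intro sum.cong refl) (simp add: AZ g(3))
    also have "\<dots> = prob (A x) * prob (Y -` B \<inter> space M)"
      using measure_vimage_simple[OF assms(3), of B] by (simp add: q_def sum_distrib_left)
    finally show ?thesis .
  qed
  have XZ: "prob ((X -` C \<inter> space M) \<inter> (Z -` B \<inter> space M)) =
      prob (X -` C \<inter> space M) * prob (Y -` B \<inter> space M)" for B C
  proof -
    have ZB: "Z -` B \<inter> space M \<in> events"
      using Z by (simp add: simple_functionD)
    have "prob ((X -` C \<inter> space M) \<inter> (Z -` B \<inter> space M)) =
        (\<Sum>x\<in>X ` space M \<inter> C. prob (A x \<inter> (Z -` B \<inter> space M)))"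
      using measure_Int_vimage_simple[OF assms(2) ZB, of C] by (simp add: A_def Int_ac)
    also have "\<dots> = (\<Sum>x\<in>X ` space M \<inter> C. prob (A x)) * prob (Y -` B \<inter> space M)"
      by (simp add: joint sum_distrib_right)
    also have "(\<Sum>x\<in>X ` space M \<inter> C. prob (A x)) = prob (X -` C \<inter> space M)"
      using measure_vimage_simple[OF assms(2), of C] by (simp add: A_def)
    finally show ?thesis .
  qed
  have law: "prob (Z -` B \<inter> space M) = prob (Y -` B \<inter> space M)" for B
    using XZ[of UNIV B] by (simp add: prob_space Int_absorb1)
  have meas: "X \<in> borel_measurable M" "Y \<in> borel_measurable M" "Z \<in> borel_measurable M"
    using assms Z by (auto intro: borel_measurable_simple_function)
  have "indep_var borel X borel Z"
    using meas by (intro indep_varI) (auto simp: XZ law)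
  moreover have "distr M borel Z = distr M borel Y"
    using meas by (intro measure_eqI) (auto simp: emeasure_distr emeasure_eq_measure law)
  ultimately show thesis
    using that Z Zin by blast
qed

section \<open>Simplex weights annihilating a subgroup\<close>

text \<open>Controls the error of the first-order expansion on both sides of 0. For negative
  \<open>x\<close> it follows from \<open>exp (- x) \<ge> 1 - x\<close> and
  \<open>(1 + x + x\<^sup>2) * (1 - x) = 1 - x * x\<^sup>2\<close>, where the cubic term
  helps.\<close>

lemma exp_le_quadratic:
  fixes x :: real
  assumes "\<bar>x\<bar> \<le> 1"
  shows "exp x \<le> 1 + x + x\<^sup>2"
proof (cases "x \<ge> 0")
  case True
  then show ?thesis using assms exp_bound[of x] by simp
next
  case False
  have "exp x = 1 / exp (- x)" by (simp add: exp_minus field_simps)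
  also have "\<dots> \<le> 1 / (1 - x)"
    using False exp_ge_add_one_self[of "- x"] by (intro divide_left_mono) auto
  also have "\<dots> \<le> 1 + x + x\<^sup>2"
  proof -
    have "(1 + x + x\<^sup>2) * (1 - x) = 1 - x * x\<^sup>2"
      by (simp add: algebra_simps power2_eq_square)
    moreover have "x * x\<^sup>2 \<le> 0"
      using False by (simp add: mult_nonpos_nonneg)
    ultimately have "1 \<le> (1 + x + x\<^sup>2) * (1 - x)" by linarith
    then show ?thesis using False by (simp add: divide_le_eq)
  qed
  finally show ?thesis .
qed

text \<open>Bolzano-Weierstrass over a finite index set. As \<open>I\<close> is a set and not a
  type, coordinatewise extraction of subsequences is applied directly, with evaluation as the
  projection.\<close>

lemma bounded_coordinates_convergent_subsequence:
  fixes f :: "nat \<Rightarrow> 'i \<Rightarrow> real"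
  assumes "finite I" "\<And>k i. i \<in> I \<Longrightarrow> \<bar>f k i\<bar> \<le> B"
  obtains l s where "strict_mono s" "\<And>i. i \<in> I \<Longrightarrow> (\<lambda>k. f (s k) i) \<longlonglongrightarrow> l i"
proof -
  have "\<forall>\<delta>\<subseteq>I. \<exists>l::'i \<Rightarrow> real. \<exists>s::nat\<Rightarrow>nat. strict_mono s \<and>
      (\<forall>e>0. eventually (\<lambda>n. \<forall>i\<in>\<delta>. dist (f (s n) i) (l i) < e) sequentially)"
    using assms
    by (intro compact_lemma_general[where proj = "\<lambda>x k. x k" and unproj = id])
       (auto simp: bounded_iff)
  then obtain l :: "'i \<Rightarrow> real" and s :: "nat \<Rightarrow> nat" where s: "strict_mono s"
      "\<And>e. e > 0 \<Longrightarrow> eventually (\<lambda>n. \<forall>i\<in>I. dist (f (s n) i) (l i) < e) sequentially"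
    by blast
  have "(\<lambda>k. f (s k) i) \<longlonglongrightarrow> l i" if "i \<in> I" for i
  proof (rule tendstoI)
    show "eventually (\<lambda>n. dist (f (s n) i) (l i) < e) sequentially" if "e > 0" for e
      using s(2)[OF that] \<open>i \<in> I\<close> by (auto elim: eventually_mono)
  qed
  with s(1) show thesis using that by blast
qed

text \<open>
  The weights are limits of \<open>exp (w i)\<close>, suitably normalised, for points \<open>w\<close> that nearly minimise
  \<open>\<Sum>i. exp (w i)\<close>: the approximate first-order condition in every direction becomes exact in the limit.
  Only steps of length \<open>1 / k\<close> are needed, so closure of \<open>D\<close> under division by naturals replaces linearity.
\<close>
lemma divisible_group_simplex_weights:
  fixes D :: "('i \<Rightarrow> real) set"
  assumes "finite I" "I \<noteq> {}" "D \<noteq> {}"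
    and add: "\<And>v w. v \<in> D \<Longrightarrow> w \<in> D \<Longrightarrow> (\<lambda>i. v i + w i) \<in> D"
    and minus: "\<And>w. w \<in> D \<Longrightarrow> (\<lambda>i. - w i) \<in> D"
    and div: "\<And>w k. w \<in> D \<Longrightarrow> k > 0 \<Longrightarrow> (\<lambda>i. w i / real k) \<in> D"
    and nonneg: "\<And>w. w \<in> D \<Longrightarrow> \<exists>i\<in>I. w i \<ge> 0"
  obtains l where "\<And>i. i \<in> I \<Longrightarrow> l i \<ge> 0" "(\<Sum>i\<in>I. l i) = 1"
    "\<And>w. w \<in> D \<Longrightarrow> (\<Sum>i\<in>I. l i * w i) = 0"
proof -
  define F where "F w = (\<Sum>i\<in>I. exp (w i))" for w :: "'i \<Rightarrow> real"
  define m where "m = Inf (F ` D)"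
  \<comment> \<open>The nonnegative coordinate keeps \<open>F\<close> at least 1 on
    \<open>D\<close>: this bounds the infimum and later keeps the limits \<open>L i\<close> from all
    being 0.\<close>
  have F1: "F w \<ge> 1" if w: "w \<in> D" for w
  proof -
    obtain i where i: "i \<in> I" "w i \<ge> 0" using nonneg w by blast
    then have "1 \<le> exp (w i)" by simp
    also have "\<dots> \<le> F w"
      unfolding F_def using assms(1) i by (intro member_le_sum) auto
    finally show ?thesis .
  qed
  have bdd: "bdd_below (F ` D)" using F1 by (intro bdd_belowI[of _ 1]) auto
  have m_le: "m \<le> F w" if "w \<in> D" for w
    unfolding m_def using bdd that by (intro cInf_lower) auto
  have m1: "m \<ge> 1" unfolding m_def using F1 assms(3) by (intro cInf_greatest) auto
  \<comment> \<open>The tolerance is the square of the step length \<open>1 / Suc k\<close> used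
    below, so it still vanishes after division by that length.\<close>
  have "\<exists>w\<in>D. F w < m + 1 / (real (Suc k))\<^sup>2" for k
    using cInf_lessD[of "F ` D" "m + 1 / (real (Suc k))\<^sup>2"] assms(3) by (auto simp: m_def)
  then obtain W where W: "\<And>k. W k \<in> D" "\<And>k. F (W k) < m + 1 / (real (Suc k))\<^sup>2"
    by metis
  have FW: "F (W k) \<le> m + 1" for k
  proof -
    have "1 / (real (Suc k))\<^sup>2 \<le> 1" by (simp add: divide_le_eq_1)
    then show ?thesis using W(2)[of k] by linarith
  qed
  have bound: "\<bar>exp (W k i)\<bar> \<le> m + 1" if "i \<in> I" for k i
  proof -
    have "exp (W k i) \<le> F (W k)"
      unfolding F_def using assms(1) that by (intro member_le_sum) auto
    then show ?thesis using FW[of k] by simp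
  qed
  \<comment> \<open>The points \<open>W k\<close> may run off to minus infinity in some coordinates,
    but their exponentials stay bounded; this is why the limit is taken of the exponentials.\<close>
  obtain L s where s: "strict_mono s" and L: "\<And>i. i \<in> I \<Longrightarrow> (\<lambda>k. exp (W (s k) i)) \<longlonglongrightarrow> L i"
    using bounded_coordinates_convergent_subsequence[OF assms(1), of "\<lambda>k i. exp (W k i)"] bound
    by metis
  have L0: "L i \<ge> 0" if "i \<in> I" for i
    by (rule LIMSEQ_le_const[OF L[OF that]]) auto
  have "(\<lambda>k. F (W (s k))) \<longlonglongrightarrow> (\<Sum>i\<in>I. L i)"
    unfolding F_def by (intro tendsto_sum L)
  then have L1: "(\<Sum>i\<in>I. L i) \<ge> 1"
    by (rule LIMSEQ_le_const) (use F1 W(1) in auto)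
  \<comment> \<open>Compare \<open>W k\<close> with \<open>W k + h * v\<close> for
    \<open>h = 1 / Suc k\<close>: \<open>F\<close> is at least \<open>m\<close> there and at most
    \<open>m + h\<^sup>2\<close> at \<open>W k\<close>, so dividing by \<open>h\<close> leaves an
    error of order \<open>h\<close>. The bound on \<open>v\<close> puts \<open>h * v i\<close> in
    the range of the quadratic estimate.\<close>
  have first_order: "(\<Sum>i\<in>I. exp (W k i) * v i) \<ge> - (1 / Suc k) * (1 + (m + 1) * (\<Sum>i\<in>I. (v i)\<^sup>2))"
    if v: "v \<in> D" and k: "\<And>i. i \<in> I \<Longrightarrow> \<bar>v i\<bar> \<le> real (Suc k)" for v k
  proof -
    define h where "h = 1 / real (Suc k)"
    have h: "h > 0" "\<And>x. x / real (Suc k) = h * x" by (auto simp: h_def)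
    have "(\<lambda>i. W k i + h * v i) \<in> D"
      using add[OF W(1) div[OF v, of "Suc k"]] by (simp add: h(2) del: of_nat_Suc)
    then have "m \<le> (\<Sum>i\<in>I. exp (W k i + h * v i))"
      using m_le unfolding F_def by fast
    also have "\<dots> \<le> (\<Sum>i\<in>I. exp (W k i) * (1 + h * v i + (h * v i)\<^sup>2))"
    proof (intro sum_mono)
      fix i assume "i \<in> I"
      then have "\<bar>h * v i\<bar> \<le> 1"
        using k[of i] by (simp add: h_def abs_mult divide_le_eq)
      then show "exp (W k i + h * v i) \<le> exp (W k i) * (1 + h * v i + (h * v i)\<^sup>2)"
        unfolding exp_add by (intro mult_left_mono exp_le_quadratic) auto
    qed
    also have "\<dots> = F (W k) + h * (\<Sum>i\<in>I. exp (W k i) * v i) + h\<^sup>2 * (\<Sum>i\<in>I. exp (W k i) * (v i)\<^sup>2)"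
      by (simp add: F_def algebra_simps power_mult_distrib sum.distrib sum_distrib_left)
    also have "(\<Sum>i\<in>I. exp (W k i) * (v i)\<^sup>2) \<le> (m + 1) * (\<Sum>i\<in>I. (v i)\<^sup>2)"
      unfolding sum_distrib_left using bound[of _ k] by (intro sum_mono mult_right_mono) auto
    also have "F (W k) \<le> m + h\<^sup>2"
      using W(2)[of k] by (simp add: h_def power_divide)
    finally have "0 \<le> h * (h + (\<Sum>i\<in>I. exp (W k i) * v i) + h * ((m + 1) * (\<Sum>i\<in>I. (v i)\<^sup>2)))"
      using h(1) by (simp add: algebra_simps power2_eq_square)
    then have "0 \<le> h + (\<Sum>i\<in>I. exp (W k i) * v i) + h * ((m + 1) * (\<Sum>i\<in>I. (v i)\<^sup>2))"
      using h(1) by (simp add: zero_le_mult_iff)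
    then show ?thesis
      unfolding h_def[symmetric] by (simp add: distrib_left)
  qed
  have ge: "(\<Sum>i\<in>I. L i * v i) \<ge> 0" if v: "v \<in> D" for v
  proof (rule LIMSEQ_le)
    show "(\<lambda>k. \<Sum>i\<in>I. exp (W (s k) i) * v i) \<longlonglongrightarrow> (\<Sum>i\<in>I. L i * v i)"
      by (intro tendsto_sum tendsto_mult L tendsto_const)
    have "(\<lambda>k. - (1 / real (Suc k)) * (1 + (m + 1) * (\<Sum>i\<in>I. (v i)\<^sup>2))) \<longlonglongrightarrow>
        - 0 * (1 + (m + 1) * (\<Sum>i\<in>I. (v i)\<^sup>2))"
      by (intro tendsto_intros LIMSEQ_Suc[OF lim_1_over_n])
    from LIMSEQ_subseq_LIMSEQ[OF this s]
    show "(\<lambda>k. - (1 / Suc (s k)) * (1 + (m + 1) * (\<Sum>i\<in>I. (v i)\<^sup>2))) \<longlonglongrightarrow> 0"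
      by (simp add: o_def)
    obtain N :: nat where N: "(\<Sum>i\<in>I. \<bar>v i\<bar>) \<le> real N"
      using real_arch_simple by blast
    show "\<exists>N. \<forall>k\<ge>N. - (1 / Suc (s k)) * (1 + (m + 1) * (\<Sum>i\<in>I. (v i)\<^sup>2))
        \<le> (\<Sum>i\<in>I. exp (W (s k) i) * v i)"
    proof (intro exI[of _ N] allI impI first_order v)
      fix k i assume "N \<le> k" "i \<in> I"
      have "\<bar>v i\<bar> \<le> (\<Sum>i\<in>I. \<bar>v i\<bar>)"
        using assms(1) \<open>i \<in> I\<close> by (intro member_le_sum) auto
      moreover have "N \<le> Suc (s k)"
        using \<open>N \<le> k\<close> seq_suble[OF s, of k] by simp
      ultimately show "\<bar>v i\<bar> \<le> real (Suc (s k))"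
        using N by linarith
    qed
  qed
  \<comment> \<open>With \<open>v\<close> the set also contains \<open>- v\<close>, so the one-sided
    condition holds in both directions.\<close>
  have eq: "(\<Sum>i\<in>I. L i * v i) = 0" if "v \<in> D" for v
    using ge[OF that] ge[OF minus[OF that]] by (simp add: sum_negf)
  show thesis
  proof (rule that[of "\<lambda>i. L i / (\<Sum>i\<in>I. L i)"])
    show "L i / (\<Sum>i\<in>I. L i) \<ge> 0" if "i \<in> I" for i
      using L0 L1 that by simp
    show "(\<Sum>i\<in>I. L i / (\<Sum>i\<in>I. L i)) = 1"
      using L1 by (simp flip: sum_divide_distrib)
    show "(\<Sum>i\<in>I. L i / (\<Sum>i\<in>I. L i) * w i) = 0" if "w \<in> D" for w
      using eq[OF that] by (simp add: times_divide_eq_left flip: sum_divide_distrib)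
  qed
qed

text \<open>Passes to the quotients \<open>w / k\<close> of elements of \<open>D\<close>, which keep
  the sign condition and form a group closed under division. Sums go through a common denominator,
  with numerators in \<open>D\<close> by \<open>mult\<close>.\<close>

lemma group_simplex_weights:
  fixes D :: "('i \<Rightarrow> real) set"
  assumes "finite I" "I \<noteq> {}" "D \<noteq> {}"
    and add: "\<And>v w. v \<in> D \<Longrightarrow> w \<in> D \<Longrightarrow> (\<lambda>i. v i + w i) \<in> D"
    and minus: "\<And>w. w \<in> D \<Longrightarrow> (\<lambda>i. - w i) \<in> D"
    and nonneg: "\<And>w. w \<in> D \<Longrightarrow> \<exists>i\<in>I. w i \<ge> 0"
  obtains l where "\<And>i. i \<in> I \<Longrightarrow> l i \<ge> 0" "(\<Sum>i\<in>I. l i) = 1"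
    "\<And>w. w \<in> D \<Longrightarrow> (\<Sum>i\<in>I. l i * w i) = 0"
proof -
  define E where "E = {\<lambda>i. w i / real k |w k. w \<in> D \<and> k > 0}"
  have mult: "(\<lambda>i. real k * w i) \<in> D" if "w \<in> D" "k > 0" for w k
    using \<open>k > 0\<close>
  proof (induction k rule: nat_induct_non_zero)
    case 1
    then show ?case using that by simp
  next
    case (Suc k)
    then show ?case using add[OF that(1) Suc.IH] by (simp add: algebra_simps)
  qed
  have EI: "(\<lambda>i. w i / real k) \<in> E" if "w \<in> D" "k > 0" for w k
    using that by (auto simp: E_def)
  have DE: "w \<in> E" if "w \<in> D" for w
    using EI[OF that, of 1] by simp
  show thesis
  proof (rule divisible_group_simplex_weights[of I E])
    show "finite I" "I \<noteq> {}" by fact+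
    show "E \<noteq> {}" using DE assms(3) by blast
    show "\<exists>i\<in>I. 0 \<le> w i" if wE: "w \<in> E" for w
    proof -
      obtain v k where v: "w = (\<lambda>i. v i / real k)" "v \<in> D"
        using wE by (auto simp: E_def)
      then show ?thesis using nonneg[OF v(2)] by (auto intro!: bexI divide_nonneg_nonneg)
    qed
    show "(\<lambda>i. - w i) \<in> E" if wE: "w \<in> E" for w
    proof -
      obtain v k where v: "w = (\<lambda>i. v i / real k)" "v \<in> D" "k > 0"
        using wE by (auto simp: E_def)
      show ?thesis using EI[OF minus[OF v(2)] v(3)] by (simp add: v(1))
    qed
    show "(\<lambda>i. w i / real j) \<in> E" if wE: "w \<in> E" and j: "j > 0" for w j
    proof -
      obtain v k where v: "w = (\<lambda>i. v i / real k)" "v \<in> D" "k > 0"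
        using wE by (auto simp: E_def)
      show ?thesis using EI[OF v(2), of "k * j"] v(3) j by (simp add: v(1))
    qed
    show "(\<lambda>i. w i + w' i) \<in> E" if wE: "w \<in> E" and wE': "w' \<in> E" for w w'
    proof -
      obtain v k where v: "w = (\<lambda>i. v i / real k)" "v \<in> D" "k > 0"
        using wE by (auto simp: E_def)
      obtain v' k' where v': "w' = (\<lambda>i. v' i / real k')" "v' \<in> D" "k' > 0"
        using wE' by (auto simp: E_def)
      have "(\<lambda>i. w i + w' i) = (\<lambda>i. (real k' * v i + real k * v' i) / real (k * k'))"
        using v(3) v'(3) by (simp add: v(1) v'(1) field_simps)
      then show ?thesis
        using EI[OF add[OF mult[OF v(2) v'(3)] mult[OF v'(2) v(3)]], of "k * k'"] v(3) v'(3) by simp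
    qed
  qed (use that DE in blast)
qed

section \<open>Statistics on finitely valued times\<close>

text \<open>Nonnegativity is asked for pointwise, so that it passes to any simple function whose
  values are among those of a member, such as an independent copy.\<close>

definition simple_times :: "'w measure \<Rightarrow> ('w \<Rightarrow> real) set" where
  "simple_times M = {T. simple_function M T \<and> (\<forall>w\<in>space M. 0 \<le> T w)}"

lemma simple_times_subset_Linf_plus: "simple_times M \<subseteq> Linf_plus M"
proof
  fix T assume T: "T \<in> simple_times M"
  then have "finite (T ` space M)"
    by (auto simp: simple_times_def simple_functionD)
  then have "AE w in M. T w \<le> Max (T ` space M)"
    by (intro AE_I2) auto
  then show "T \<in> Linf_plus M"
    using T by (auto simp: simple_times_def Linf_plus_def borel_measurable_simple_function)
qed

lemma simple_times_const: "0 \<le> c \<Longrightarrow> (\<lambda>_. c) \<in> simple_times M"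
  by (simp add: simple_times_def)

lemma Linf_plus_const: "0 \<le> c \<Longrightarrow> (\<lambda>_. c) \<in> Linf_plus M"
  using simple_times_const simple_times_subset_Linf_plus by blast

lemma Linf_plus_add_const:
  assumes "X \<in> Linf_plus M" "0 \<le> c"
  shows "(\<lambda>w. X w + c) \<in> Linf_plus M"
proof -
  obtain B where X: "X \<in> borel_measurable M" "AE w in M. 0 \<le> X w" "AE w in M. X w \<le> B"
    using assms(1) unfolding Linf_plus_def by blast
  have "AE w in M. 0 \<le> X w + c"
    using X(2) by eventually_elim (simp add: assms(2))
  moreover have "AE w in M. X w + c \<le> B + c"
    using X(3) by eventually_elim simp
  moreover have "(\<lambda>w. X w + c) \<in> borel_measurable M"
    using X(1) by simp
  ultimately show ?thesis
    unfolding Linf_plus_def by blast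
qed

lemma monotone_additive_statistic_const:
  assumes "monotone_additive_statistic M \<Phi>" "0 \<le> c"
  shows "\<Phi> (\<lambda>_. c) = c"
  using assms by (simp add: monotone_additive_statistic_def)

lemma monotone_additive_statistic_distr_cong:
  assumes "monotone_additive_statistic M \<Phi>" "X \<in> Linf_plus M" "Y \<in> Linf_plus M"
    "distr M borel X = distr M borel Y"
  shows "\<Phi> X = \<Phi> Y"
  using assms unfolding monotone_additive_statistic_def by blast

lemma monotone_additive_statistic_add:
  assumes "monotone_additive_statistic M \<Phi>" "X \<in> Linf_plus M" "Y \<in> Linf_plus M"
    "prob_space.indep_var M borel X borel Y"
  shows "\<Phi> (\<lambda>w. X w + Y w) = \<Phi> X + \<Phi> Y"
  using assms unfolding monotone_additive_statistic_def by blast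

text \<open>A constant is independent of every random variable, so additivity applies.\<close>

lemma (in prob_space) monotone_additive_statistic_add_const:
  assumes "monotone_additive_statistic M \<Phi>" "X \<in> Linf_plus M" "0 \<le> c"
  shows "\<Phi> (\<lambda>w. X w + c) = \<Phi> X + c"
proof -
  have "indep_var borel X borel (\<lambda>_. c)"
    using assms by (intro indep_var_const) (auto simp: Linf_plus_def)
  then show ?thesis
    using monotone_additive_statistic_add[OF assms(1,2) Linf_plus_const[OF assms(3)]]
      monotone_additive_statistic_const[OF assms(1,3)] by simp
qed

text \<open>Almost sure domination reverses the order of the distribution functions, which is
  first-order dominance.\<close>

lemma (in prob_space) monotone_additive_statistic_mono_AE:
  assumes "monotone_additive_statistic M \<Phi>" "X \<in> Linf_plus M" "Y \<in> Linf_plus M"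
    and le: "AE w in M. X w \<le> Y w"
  shows "\<Phi> X \<le> \<Phi> Y"
proof -
  have meas: "X \<in> borel_measurable M" "Y \<in> borel_measurable M"
    using assms by (auto simp: Linf_plus_def)
  have "cdf (distr M borel Y) t \<le> cdf (distr M borel X) t" for t
  proof -
    have "prob (Y -` {..t} \<inter> space M) \<le> prob (X -` {..t} \<inter> space M)"
      using meas le by (intro finite_measure_mono_AE) auto
    then show ?thesis
      using meas by (simp add: cdf_def measure_distr)
  qed
  then have "fosd M Y X" by (simp add: fosd_def)
  then show ?thesis
    using assms(1-3) unfolding monotone_additive_statistic_def by blast
qed

text \<open>\<open>W\<close> is \<open>X\<close> plus a copy of \<open>Y\<close> independent of
  \<open>X\<close>. One \<open>W\<close> serves all statistics at once, as is needed to add whole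
  vectors of their values.\<close>

lemma (in prob_space) simple_times_indep_sum:
  assumes "nonatomic M" "X \<in> simple_times M" "Y \<in> simple_times M"
  obtains W where "W \<in> simple_times M"
    "\<And>\<Phi>. monotone_additive_statistic M \<Phi> \<Longrightarrow> \<Phi> W = \<Phi> X + \<Phi> Y"
proof -
  obtain Z where Z: "simple_function M Z" "Z ` space M \<subseteq> Y ` space M"
      "indep_var borel X borel Z" "distr M borel Z = distr M borel Y"
    using nonatomic_indep_copy[OF assms(1), of X Y] assms(2,3) by (auto simp: simple_times_def)
  have ZS: "Z \<in> simple_times M"
    unfolding simple_times_def
  proof (intro CollectI conjI ballI Z(1))
    fix w assume "w \<in> space M"
    then have "Z w \<in> Y ` space M" using Z(2) by blast
    then show "0 \<le> Z w" using assms(3) by (auto simp: simple_times_def)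
  qed
  have XYZ: "X \<in> Linf_plus M" "Y \<in> Linf_plus M" "Z \<in> Linf_plus M"
    using assms(2,3) ZS simple_times_subset_Linf_plus by blast+
  have "(\<lambda>w. X w + Z w) \<in> simple_times M"
    using assms(2) ZS by (auto simp: simple_times_def)
  moreover have "\<Phi> (\<lambda>w. X w + Z w) = \<Phi> X + \<Phi> Y" if "monotone_additive_statistic M \<Phi>" for \<Phi>
    using monotone_additive_statistic_add[OF that XYZ(1,3) Z(3)]
      monotone_additive_statistic_distr_cong[OF that XYZ(3,2) Z(4)] by simp
  ultimately show thesis using that by blast
qed

text \<open>Rounding \<open>T\<close> down to multiples of \<open>e\<close> gives
  \<open>S \<le> T \<le> S + e\<close> almost surely; monotonicity and additivity of constants carry
  this over to every statistic, with the same \<open>S\<close>.\<close>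

lemma (in prob_space) simple_times_approx:
  assumes T: "T \<in> Linf_plus M" and "e > 0"
  obtains S where "S \<in> simple_times M"
    "\<And>\<Phi>. monotone_additive_statistic M \<Phi> \<Longrightarrow> \<bar>\<Phi> T - \<Phi> S\<bar> \<le> e"
proof -
  obtain B0 where B0: "AE w in M. T w \<le> B0"
    using T by (auto simp: Linf_plus_def)
  define B where "B = max B0 0"
  \<comment> \<open>\<open>T\<close> obeys its bounds only almost surely, while \<open>S\<close>
    must be nonnegative and finitely valued everywhere, hence the truncation to the interval from 0
    to \<open>B\<close>.\<close>
  define T' where "T' w = max 0 (min (T w) B)" for w
  define S where "S w = e * of_int \<lfloor>T' w / e\<rfloor>" for w
  have Tm [measurable]: "T \<in> borel_measurable M"
    using T by (simp add: Linf_plus_def)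
  have T'm [measurable]: "T' \<in> borel_measurable M"
    unfolding T'_def by measurable
  have T'B: "0 \<le> T' w" "T' w \<le> B" for w
    by (auto simp: T'_def B_def)
  have S: "S w \<le> T' w" "T' w \<le> S w + e" "0 \<le> S w" for w
  proof -
    define k where "k = real_of_int \<lfloor>T' w / e\<rfloor>"
    have "k \<le> T' w / e" "T' w / e \<le> k + 1"
      unfolding k_def by linarith+
    then show "S w \<le> T' w" "T' w \<le> S w + e"
      using assms(2) by (simp_all add: S_def field_simps flip: k_def)
    show "0 \<le> S w"
      using assms(2) T'B by (simp add: S_def)
  qed
  have "S ` space M \<subseteq> (\<lambda>i. e * of_int i) ` {0..\<lfloor>B / e\<rfloor>}"
    using assms(2) T'B by (auto simp: S_def intro!: imageI floor_mono divide_right_mono)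
  then have "finite (S ` space M)"
    by (rule finite_subset) auto
  moreover have "S \<in> borel_measurable M"
    unfolding S_def by measurable
  ultimately have SS: "S \<in> simple_times M"
    using S(3) by (auto simp: simple_times_def intro: simple_function_borel_measurable)
  have TT': "AE w in M. T' w = T w"
    using T B0 by (auto simp: T'_def B_def Linf_plus_def)
  have "\<bar>\<Phi> T - \<Phi> S\<bar> \<le> e" if \<Phi>: "monotone_additive_statistic M \<Phi>" for \<Phi>
  proof -
    have SL: "S \<in> Linf_plus M"
      using SS simple_times_subset_Linf_plus by blast
    have "AE w in M. S w \<le> T w"
      using TT' by eventually_elim (use S(1) in metis)
    then have "\<Phi> S \<le> \<Phi> T"
      by (rule monotone_additive_statistic_mono_AE[OF \<Phi> SL T])
    moreover have "AE w in M. T w \<le> S w + e"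
      using TT' by eventually_elim (use S(2) in metis)
    then have "\<Phi> T \<le> \<Phi> (\<lambda>w. S w + e)"
      using assms(2) by (intro monotone_additive_statistic_mono_AE[OF \<Phi> T] Linf_plus_add_const SL) auto
    moreover have "\<Phi> (\<lambda>w. S w + e) = \<Phi> S + e"
      using assms(2) by (intro monotone_additive_statistic_add_const \<Phi> SL) auto
    ultimately show ?thesis by simp
  qed
  with SS show thesis using that by blast
qed

section \<open>Utility ratios and discounted comparisons\<close>

text \<open>By the intermediate value theorem: if \<open>u\<close> vanishes at 0, fix
  \<open>y = 1\<close> and lower \<open>x\<close>; if \<open>u\<close> is unbounded, fix
  \<open>x = 1\<close> and raise \<open>y\<close>.\<close>

lemma admissible_utility_ratio_le_1:
  assumes u: "admissible_utility u"
    and unbounded: "(u \<longlongrightarrow> 0) (at_right 0) \<or> filterlim u at_top at_top"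
    and c: "0 < c" "c \<le> 1"
  obtains x y where "x > 0" "y > 0" "u x = c * u y"
proof -
  have cont: "continuous_on {a..b} u" if "a > 0" for a b
    using u that unfolding admissible_utility_def by (auto intro: continuous_on_subset)
  have pos: "u x > 0" if "x > 0" for x
    using u that by (simp add: admissible_utility_def)
  show thesis
    using unbounded
  proof
    assume "(u \<longlongrightarrow> 0) (at_right 0)"
    then have "eventually (\<lambda>x. u x < c * u 1) (at_right 0)"
      using pos[of 1] c by (intro order_tendstoD) auto
    moreover have "eventually (\<lambda>x. x \<in> {0<..<1}) (at_right (0 :: real))"
      by (rule eventually_at_right_real) simp
    ultimately have "eventually (\<lambda>x. u x < c * u 1 \<and> x \<in> {0<..<1}) (at_right 0)"
      by eventually_elim simp
    then obtain a where a: "u a < c * u 1" "0 < a" "a < 1"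
      using eventually_happens by fastforce
    then obtain x where "a \<le> x" "x \<le> 1" "u x = c * u 1"
      using IVT'[of u a "c * u 1" 1] cont[OF a(2)] pos[of 1] c by auto
    then show thesis using that[of x 1] a by auto
  next
    assume "filterlim u at_top at_top"
    then have "eventually (\<lambda>y. u 1 / c \<le> u y) at_top"
      by (simp add: filterlim_at_top)
    moreover have "eventually (\<lambda>y. y \<ge> (1 :: real)) at_top"
      by (rule eventually_ge_at_top)
    ultimately have "eventually (\<lambda>y. u 1 / c \<le> u y \<and> y \<ge> 1) at_top"
      by eventually_elim simp
    then obtain b where b: "u 1 / c \<le> u b" "b \<ge> 1"
      using eventually_happens by fastforce
    have "u 1 \<le> u 1 / c"
      using c pos[of 1] by (simp add: le_divide_eq)
    then obtain y where "1 \<le> y" "y \<le> b" "u y = u 1 / c"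
      using IVT'[of u 1 "u 1 / c" b] cont[of 1 b] b by auto
    then show thesis using that[of 1 y] c by auto
  qed
qed

text \<open>Ratios above 1 arise by exchanging the two payoffs.\<close>

lemma admissible_utility_ratio:
  assumes "admissible_utility u"
    and "(u \<longlongrightarrow> 0) (at_right 0) \<or> filterlim u at_top at_top"
    and "c > 0"
  obtains x y where "x > 0" "y > 0" "u x = c * u y"
proof (cases "c \<le> 1")
  case True
  then show thesis
    using admissible_utility_ratio_le_1[OF assms] that by blast
next
  case False
  then obtain x y where xy: "x > 0" "y > 0" "u x = 1 / c * u y"
    using admissible_utility_ratio_le_1[OF assms(1,2), of "1 / c"] by auto
  then show thesis using that[of y x] assms(3) by simp
qed

lemma discounted_le_iff:
  fixes a b :: real
  assumes "a > 0" "b > 0"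
  shows "b * exp (- s) \<le> a * exp (- t) \<longleftrightarrow> t - s \<le> ln (a / b)"
proof -
  have "b * exp (- s) \<le> a * exp (- t) \<longleftrightarrow> exp (t - s) \<le> a / b"
    using assms by (simp add: exp_diff exp_minus field_simps)
  also have "\<dots> \<longleftrightarrow> t - s \<le> ln (a / b)"
    using assms by (subst ln_ge_iff) auto
  finally show ?thesis .
qed

section \<open>The Pareto axiom and weighted averages of statistics\<close>

theorem proposition4:
  fixes M :: "'w measure"
    and n :: nat
    and Rs :: "nat \<Rightarrow> 'w preference" and R :: "'w preference"
    and \<Phi>s :: "nat \<Rightarrow> ('w \<Rightarrow> real) \<Rightarrow> real" and \<Phi> :: "('w \<Rightarrow> real) \<Rightarrow> real"
    and rs :: "nat \<Rightarrow> real" and r :: real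
    and u :: "real \<Rightarrow> real"
  assumes "prob_space M" and "nonatomic M"
    and "n \<ge> 1"
    and "\<And>i. i \<in> {1..n} \<Longrightarrow> MSTP M (Rs i)" and "MSTP M R"
    and "\<And>i. i \<in> {1..n} \<Longrightarrow> monotone_additive_statistic M (\<Phi>s i)"
    and "monotone_additive_statistic M \<Phi>"
    and "\<And>i. i \<in> {1..n} \<Longrightarrow> rs i > 0" and "r > 0"
    and "admissible_utility u"
    and "\<And>i. i \<in> {1..n} \<Longrightarrow> represented_by M (Rs i) (\<lambda>x T. u x * exp (- rs i * \<Phi>s i T))"
    and "represented_by M R (\<lambda>x T. u x * exp (- r * \<Phi> T))"
    and "(u \<longlongrightarrow> 0) (at_right 0) \<or> filterlim u at_top at_top"
  shows "pareto M n Rs R \<longleftrightarrow>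
    (\<exists>l :: nat \<Rightarrow> real.
       (\<forall>i\<in>{1..n}. l i \<ge> 0) \<and> (\<Sum>i=1..n. l i) = 1 \<and>
       r = (\<Sum>i=1..n. l i * rs i) \<and>
       (\<forall>T\<in>Linf_plus M. r * \<Phi> T = (\<Sum>i=1..n. l i * rs i * \<Phi>s i T)))"
proof -
  interpret prob_space M by fact
  have pos: "u x > 0" if "x > 0" for x
    using assms(10) that by (simp add: admissible_utility_def)
  have Rs_iff: "Rs i (x, T) (y, S) \<longleftrightarrow> rs i * \<Phi>s i T - rs i * \<Phi>s i S \<le> ln (u x / u y)"
    if "i \<in> {1..n}" "x > 0" "y > 0" "T \<in> Linf_plus M" "S \<in> Linf_plus M" for i x y T S
    using assms(11)[OF that(1)] that(2-) discounted_le_iff[OF pos[OF that(2)] pos[OF that(3)]]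
    by (simp add: represented_by_def time_lotteries_def)
  have R_iff: "R (x, T) (y, S) \<longleftrightarrow> r * \<Phi> T - r * \<Phi> S \<le> ln (u x / u y)"
    if "x > 0" "y > 0" "T \<in> Linf_plus M" "S \<in> Linf_plus M" for x y T S
    using assms(12) that discounted_le_iff[OF pos[OF that(1)] pos[OF that(2)]]
    by (simp add: represented_by_def time_lotteries_def)
  show ?thesis
  proof
    assume "\<exists>l :: nat \<Rightarrow> real.
       (\<forall>i\<in>{1..n}. l i \<ge> 0) \<and> (\<Sum>i=1..n. l i) = 1 \<and>
       r = (\<Sum>i=1..n. l i * rs i) \<and>
       (\<forall>T\<in>Linf_plus M. r * \<Phi> T = (\<Sum>i=1..n. l i * rs i * \<Phi>s i T))"
    then obtain l :: "nat \<Rightarrow> real" where l: "\<And>i. i \<in> {1..n} \<Longrightarrow> l i \<ge> 0" "(\<Sum>i=1..n. l i) = 1"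
        "\<And>T. T \<in> Linf_plus M \<Longrightarrow> r * \<Phi> T = (\<Sum>i=1..n. l i * rs i * \<Phi>s i T)"
      by blast
    show "pareto M n Rs R"
      unfolding pareto_def
    proof (intro ballI impI)
      fix a b assume ab: "a \<in> time_lotteries M" "b \<in> time_lotteries M" "\<forall>i\<in>{1..n}. Rs i a b"
      obtain x T y S where xy: "a = (x, T)" "b = (y, S)"
        by fastforce
      have dom: "x > 0" "y > 0" "T \<in> Linf_plus M" "S \<in> Linf_plus M"
        using ab(1,2) by (auto simp: xy time_lotteries_def)
      \<comment> \<open>The common \<open>u\<close> gives all agents the same threshold
        \<open>ln (u x / u y)\<close>, which survives averaging with weights of sum 1.\<close>
      have "r * \<Phi> T - r * \<Phi> S = (\<Sum>i=1..n. l i * (rs i * \<Phi>s i T - rs i * \<Phi>s i S))"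
        by (simp add: l(3) dom algebra_simps sum_subtractf)
      also have "\<dots> \<le> (\<Sum>i=1..n. l i * ln (u x / u y))"
        using ab(3) dom l(1) Rs_iff by (intro sum_mono mult_left_mono) (auto simp: xy)
      also have "\<dots> = ln (u x / u y)"
        using l(2) by (simp flip: sum_distrib_right)
      finally show "R a b"
        using dom R_iff by (simp add: xy)
    qed
  next
    assume pareto: "pareto M n Rs R"
    define gap where "gap T S i = rs i * (\<Phi>s i T - \<Phi>s i S) - r * (\<Phi> T - \<Phi> S)" for T S i
    \<comment> \<open>Only the coordinates in \<open>{1..n}\<close> are prescribed, since additivity
      of \<open>\<Phi>s i\<close> is available only for these \<open>i\<close>.\<close>
    define D where "D = {w. \<exists>T\<in>simple_times M. \<exists>S\<in>simple_times M. \<forall>i\<in>{1..n}. w i = gap T S i}"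
    have sub: "T \<in> Linf_plus M" if "T \<in> simple_times M" for T
      using that simple_times_subset_Linf_plus by blast
    have gap_nonneg: "\<exists>i\<in>{1..n}. gap T S i \<ge> 0" if TS: "T \<in> Linf_plus M" "S \<in> Linf_plus M" for T S
    proof -
      let ?d = "\<lambda>i. rs i * (\<Phi>s i T - \<Phi>s i S)"
      \<comment> \<open>Payoffs with log ratio exactly \<open>d\<close> make every agent weakly
        prefer \<open>(x, T)\<close>, the maximiser \<open>j\<close> being indifferent. Pareto then
        bounds the social difference by that of \<open>j\<close>.\<close>
      define d where "d = Max (?d ` {1..n})"
      have le_d: "?d i \<le> d" if "i \<in> {1..n}" for i
        using that by (auto simp: d_def)
      have "d \<in> ?d ` {1..n}"
        unfolding d_def using assms(3) by (intro Max_in) auto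
      then obtain j where j: "j \<in> {1..n}" "d = ?d j" by blast
      obtain x y where xy: "x > 0" "y > 0" "u x = exp d * u y"
        using admissible_utility_ratio[OF assms(10,13)] exp_gt_zero by metis
      then have "ln (u x / u y) = d"
        using pos[of y] by simp
      then have "Rs i (x, T) (y, S)" if "i \<in> {1..n}" for i
        using Rs_iff[OF that xy(1,2) TS] le_d[OF that] by (simp add: right_diff_distrib)
      then have "R (x, T) (y, S)"
        using pareto xy TS by (simp add: pareto_def time_lotteries_def)
      then have "gap T S j \<ge> 0"
        using R_iff[OF xy(1,2) TS] \<open>ln (u x / u y) = d\<close> j(2) by (simp add: gap_def right_diff_distrib)
      with j(1) show ?thesis by blast
    qed
    have D_add: "(\<lambda>i. v i + w i) \<in> D" if vw: "v \<in> D" "w \<in> D" for v w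
    proof -
      obtain T S where TS: "T \<in> simple_times M" "S \<in> simple_times M" "\<forall>i\<in>{1..n}. v i = gap T S i"
        using vw(1) by (auto simp: D_def)
      obtain T' S' where TS': "T' \<in> simple_times M" "S' \<in> simple_times M" "\<forall>i\<in>{1..n}. w i = gap T' S' i"
        using vw(2) by (auto simp: D_def)
      obtain U where U: "U \<in> simple_times M"
          "\<And>\<Psi>. monotone_additive_statistic M \<Psi> \<Longrightarrow> \<Psi> U = \<Psi> T + \<Psi> T'"
        using simple_times_indep_sum[OF assms(2) TS(1) TS'(1)] by blast
      obtain V where V: "V \<in> simple_times M"
          "\<And>\<Psi>. monotone_additive_statistic M \<Psi> \<Longrightarrow> \<Psi> V = \<Psi> S + \<Psi> S'"
        using simple_times_indep_sum[OF assms(2) TS(2) TS'(2)] by blast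
      have "gap U V i = gap T S i + gap T' S' i" if "i \<in> {1..n}" for i
        unfolding gap_def U(2)[OF assms(7)] V(2)[OF assms(7)] U(2)[OF assms(6)[OF that]]
          V(2)[OF assms(6)[OF that]]
        by (simp add: algebra_simps)
      then have "\<forall>i\<in>{1..n}. v i + w i = gap U V i"
        using TS(3) TS'(3) by simp
      then show ?thesis
        using U(1) V(1) unfolding D_def by blast
    qed
    have D_minus: "(\<lambda>i. - w i) \<in> D" if w: "w \<in> D" for w
    proof -
      obtain T S where TS: "T \<in> simple_times M" "S \<in> simple_times M" "\<forall>i\<in>{1..n}. w i = gap T S i"
        using w by (auto simp: D_def)
      have "gap S T i = - gap T S i" for i
        by (simp add: gap_def algebra_simps)
      then have "\<forall>i\<in>{1..n}. - w i = gap S T i"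
        using TS(3) by simp
      then show ?thesis
        using TS(1,2) unfolding D_def by blast
    qed
    have gap_D: "gap T S \<in> D" if "T \<in> simple_times M" "S \<in> simple_times M" for T S
      using that by (auto simp: D_def)
    have "\<exists>l. (\<forall>i\<in>{1..n}. l i \<ge> 0) \<and> (\<Sum>i=1..n. l i) = 1 \<and> (\<forall>w\<in>D. (\<Sum>i=1..n. l i * w i) = 0)"
    proof (rule group_simplex_weights[of "{1..n}" D])
      show "D \<noteq> {}" using gap_D[OF simple_times_const simple_times_const] by auto
      show "\<exists>i\<in>{1..n}. w i \<ge> 0" if "w \<in> D" for w
        using that gap_nonneg sub by (fastforce simp: D_def)
      show ?thesis if "\<And>i. i \<in> {1..n} \<Longrightarrow> l i \<ge> 0" "(\<Sum>i=1..n. l i) = 1"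
        "\<And>w. w \<in> D \<Longrightarrow> (\<Sum>i=1..n. l i * w i) = 0" for l
        using that by blast
    qed (use assms(3) D_add D_minus in auto)
    then obtain l where l: "\<And>i. i \<in> {1..n} \<Longrightarrow> l i \<ge> 0" "(\<Sum>i=1..n. l i) = 1"
        "\<And>w. w \<in> D \<Longrightarrow> (\<Sum>i=1..n. l i * w i) = 0"
      by blast
    have zero: "\<Psi> (\<lambda>_. 0) = 0" if "monotone_additive_statistic M \<Psi>" for \<Psi>
      using monotone_additive_statistic_const[OF that, of 0] by simp
    have simple: "r * \<Phi> T = (\<Sum>i=1..n. l i * rs i * \<Phi>s i T)" if T: "T \<in> simple_times M" for T
    proof -
      \<comment> \<open>Against the zero time, where all statistics vanish, the annihilated gap
        becomes the identity for \<open>T\<close> itself.\<close>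
      have "0 = (\<Sum>i=1..n. l i * gap T (\<lambda>_. 0) i)"
        using l(3)[OF gap_D[OF T simple_times_const]] by simp
      also have "\<dots> = (\<Sum>i=1..n. l i * rs i * \<Phi>s i T - l i * (r * \<Phi> T))"
        using assms(6,7) by (intro sum.cong) (auto simp: gap_def zero algebra_simps)
      also have "\<dots> = (\<Sum>i=1..n. l i * rs i * \<Phi>s i T) - r * \<Phi> T"
        using l(2) by (simp add: sum_subtractf flip: sum_distrib_right)
      finally show ?thesis by simp
    qed
    \<comment> \<open>The identity for \<open>r\<close> is the one for statistics at the constant
      time 1.\<close>
    have r_eq: "r = (\<Sum>i=1..n. l i * rs i)"
    proof -
      have "r = r * \<Phi> (\<lambda>_. 1)"
        using monotone_additive_statistic_const[OF assms(7), of 1] by simp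
      also have "\<dots> = (\<Sum>i=1..n. l i * rs i * \<Phi>s i (\<lambda>_. 1))"
        by (intro simple simple_times_const) simp
      also have "\<dots> = (\<Sum>i=1..n. l i * rs i)"
        using monotone_additive_statistic_const[OF assms(6), of _ 1] by (intro sum.cong) auto
      finally show ?thesis .
    qed
    have "r * \<Phi> T = (\<Sum>i=1..n. l i * rs i * \<Phi>s i T)" if T: "T \<in> Linf_plus M" for T
    proof -
      \<comment> \<open>Both sides change by at most \<open>e / 2\<close> when \<open>T\<close> is
        replaced by \<open>S\<close>: the social side has factor \<open>r\<close>, and the weights
        \<open>l i * rs i\<close> also sum to \<open>r\<close> by \<open>r_eq\<close>.\<close>
      have "\<bar>r * \<Phi> T - (\<Sum>i=1..n. l i * rs i * \<Phi>s i T)\<bar> \<le> 0 + e" if "e > 0" for e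
      proof -
        obtain S where S: "S \<in> simple_times M"
            "\<And>\<Psi>. monotone_additive_statistic M \<Psi> \<Longrightarrow> \<bar>\<Psi> T - \<Psi> S\<bar> \<le> e / (2 * r)"
          using simple_times_approx[OF T, of "e / (2 * r)"] \<open>e > 0\<close> assms(9) by auto
        have "r * \<Phi> T - (\<Sum>i=1..n. l i * rs i * \<Phi>s i T) =
            r * (\<Phi> T - \<Phi> S) - (\<Sum>i=1..n. l i * rs i * (\<Phi>s i T - \<Phi>s i S))"
          using simple[OF S(1)] by (simp add: algebra_simps sum_subtractf)
        also have "\<bar>\<dots>\<bar> \<le> \<bar>r * (\<Phi> T - \<Phi> S)\<bar> + \<bar>\<Sum>i=1..n. l i * rs i * (\<Phi>s i T - \<Phi>s i S)\<bar>"
          by (rule abs_triangle_ineq4)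
        also have "\<bar>r * (\<Phi> T - \<Phi> S)\<bar> \<le> r * (e / (2 * r))"
          using mult_left_mono[OF S(2)[OF assms(7)], of r] assms(9) by (simp only: abs_mult abs_of_pos less_imp_le)
        also have "\<bar>\<Sum>i=1..n. l i * rs i * (\<Phi>s i T - \<Phi>s i S)\<bar> \<le> (\<Sum>i=1..n. l i * rs i * (e / (2 * r)))"
        proof (intro order_trans[OF sum_abs] sum_mono)
          fix i assume i: "i \<in> {1..n}"
          have "l i * rs i \<ge> 0"
            using l(1)[OF i] assms(8)[OF i] by simp
          then show "\<bar>l i * rs i * (\<Phi>s i T - \<Phi>s i S)\<bar> \<le> l i * rs i * (e / (2 * r))"
            using mult_left_mono[OF S(2)[OF assms(6)[OF i]], of "l i * rs i"]
            by (simp only: abs_mult[of "l i * rs i"] abs_of_nonneg)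
        qed
        also have "\<dots> = r * (e / (2 * r))"
          by (simp only: r_eq flip: sum_distrib_right)
        also have "r * (e / (2 * r)) + r * (e / (2 * r)) = 0 + e"
          using assms(9) by simp
        finally show ?thesis by simp
      qed
      then have "\<bar>r * \<Phi> T - (\<Sum>i=1..n. l i * rs i * \<Phi>s i T)\<bar> \<le> 0"
        by (rule field_le_epsilon)
      then show ?thesis by simp
    qed
    with l(1,2) r_eq show "\<exists>l :: nat \<Rightarrow> real.
       (\<forall>i\<in>{1..n}. l i \<ge> 0) \<and> (\<Sum>i=1..n. l i) = 1 \<and>
       r = (\<Sum>i=1..n. l i * rs i) \<and>
       (\<forall>T\<in>Linf_plus M. r * \<Phi> T = (\<Sum>i=1..n. l i * rs i * \<Phi>s i T))"
      by blast
  qed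
qed

end
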